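(* Let $G$ be a bridgeless graph and let $k \in \{2,3,4,5\}$. If $G$ admits an oriented $k$-cycle double cover, then: (i) $\phi_2(G) = 2$ if $k \le 3$; (ii) $\phi_2(G) \le 1+\sqrt{2}$ if $k = 4$; (iii) $\phi_2(G) \le \tau^2$ if $k = 5$, where $\tau = \frac{1+\sqrt{5}}{2}$ is the golden ratio.
   Context: For a real number $r \ge 2$ and a positive integer $d$, a $d$-dimensional nowhere-zero $r$-flow ($(r,d)$-NZF) on a graph $G$ is an orientation of $G$ together with a map $\varphi\colon E(G)\to\mathbb{R}^d$ such that the Euclidean norm of $\varphi(e)$ lies in $[1,r-1]$ for every edge $e$, and at every vertex the sum of the values on outgoing edges equals the sum of the values on incoming edges (Kirchhoff's law). For a bridgeless graph $G$, $\phi_d(G)$ is the infimum of all real $r\ge 2$ such that $G$ admits an $(r,d)$-NZF. A cycle is a subgraph in which every vertex has even degree (the empty subgraph counts as a cycle). For an orientation $O$ of a graph, a subgraph $H$ of the oriented graph is a directed cycle if every vertex of $H$ has equal indegree and outdegree in $H$. An oriented $k$-cycle double cover of $G$ is a collection of $k$ directed cycles $O_1(C_1),\dots,O_k(C_k)$ (each $C_i$ a cycle of $G$ with orientation $O_i$, making it a directed cycle) such that every edge of $G$ belongs to exactly two of the $C_i$, say $C_i$ and $C_j$, and the orientations $O_i$ and $O_j$ are opposite on that edge. *)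

theory Defs
  imports "HOL-Analysis.Analysis" "Graph_Theory.Digraph"
begin

text \<open>Finite undirected graphs; parallel edges and loops are allowed (a loop at \<open>v\<close> has
  end set \<open>{v}\<close>).\<close>

record ('v, 'e) ugraph =
  vertices :: "'v set"
  edges :: "'e set"
  ends :: "'e \<Rightarrow> 'v set"

definition wf_ugraph :: "('v, 'e) ugraph \<Rightarrow> bool" where
  "wf_ugraph G \<longleftrightarrow> finite (vertices G) \<and> finite (edges G) \<and>
     (\<forall>e\<in>edges G. \<exists>u\<in>vertices G. \<exists>v\<in>vertices G. ends G e = {u, v})"

definition subgraph_of :: "('v, 'e) ugraph \<Rightarrow> ('v, 'e) ugraph \<Rightarrow> bool" where
  "subgraph_of H G \<longleftrightarrow> wf_ugraph H \<and> vertices H \<subseteq> vertices G \<and> edges H \<subseteq> edges G \<and>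
     (\<forall>e\<in>edges H. ends H e = ends G e)"

text \<open>The second summand makes each loop count twice.\<close>

definition degree_of :: "('v, 'e) ugraph \<Rightarrow> 'v \<Rightarrow> nat" where
  "degree_of G v = card {e \<in> edges G. v \<in> ends G e} + card {e \<in> edges G. ends G e = {v}}"

definition adjacency :: "('v, 'e) ugraph \<Rightarrow> ('v \<times> 'v) set" where
  "adjacency G = {(u, v). \<exists>e\<in>edges G. ends G e = {u, v}}"

definition components :: "('v, 'e) ugraph \<Rightarrow> 'v set set" where
  "components G = vertices G // ((adjacency G)\<^sup>* \<inter> vertices G \<times> vertices G)"

definition delete_edge :: "('v, 'e) ugraph \<Rightarrow> 'e \<Rightarrow> ('v, 'e) ugraph" where
  "delete_edge G e = G\<lparr>edges := edges G - {e}\<rparr>"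

definition is_bridge :: "('v, 'e) ugraph \<Rightarrow> 'e \<Rightarrow> bool" where
  "is_bridge G e \<longleftrightarrow> e \<in> edges G \<and> card (components G) < card (components (delete_edge G e))"

definition bridgeless :: "('v, 'e) ugraph \<Rightarrow> bool" where
  "bridgeless G \<longleftrightarrow> (\<forall>e\<in>edges G. \<not> is_bridge G e)"

text \<open>An orientation of \<open>G\<close> is a directed multigraph on the same vertices and edges. A loop has
  only one orientation here; the choice between its two directions never affects Kirchhoff's law
  or the balance of in- and outdegrees.\<close>

definition orientation_of :: "('v, 'e) pre_digraph \<Rightarrow> ('v, 'e) ugraph \<Rightarrow> bool" where
  "orientation_of D G \<longleftrightarrow> verts D = vertices G \<and> arcs D = edges G \<and>
     (\<forall>e\<in>edges G. ends G e = {tail D e, head D e})"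

definition nowhere_zero_flow ::
  "real \<Rightarrow> ('v, 'e) ugraph \<Rightarrow> ('v, 'e) pre_digraph \<Rightarrow> ('e \<Rightarrow> real ^ 'd) \<Rightarrow> bool" where
  "nowhere_zero_flow r G D \<phi> \<longleftrightarrow> orientation_of D G \<and>
     (\<forall>e\<in>edges G. norm (\<phi> e) \<in> {1..r - 1}) \<and>
     (\<forall>v\<in>vertices G. (\<Sum>e\<in>out_arcs D v. \<phi> e) = (\<Sum>e\<in>in_arcs D v. \<phi> e))"

text \<open>The dimension \<open>d\<close> is the cardinality of the index type \<open>'d\<close>. The set is bounded below
  by 2 and, for bridgeless graphs, nonempty by Seymour's 6-flow theorem.\<close>

definition flow_number :: "'d::finite itself \<Rightarrow> ('v, 'e) ugraph \<Rightarrow> real" where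
  "flow_number TYPE('d) G =
     Inf {r. 2 \<le> r \<and> (\<exists>D (\<phi> :: 'e \<Rightarrow> real ^ 'd). nowhere_zero_flow r G D \<phi>)}"

definition cycle_of :: "('v, 'e) ugraph \<Rightarrow> ('v, 'e) ugraph \<Rightarrow> bool" where
  "cycle_of C G \<longleftrightarrow> subgraph_of C G \<and> (\<forall>v\<in>vertices C. even (degree_of C v))"

definition directed_cycle :: "('v, 'e) pre_digraph \<Rightarrow> bool" where
  "directed_cycle D \<longleftrightarrow> (\<forall>v\<in>verts D. in_degree D v = out_degree D v)"

text \<open>The family is indexed, so members may be empty or repeated.\<close>

definition oriented_cycle_double_cover ::
  "nat \<Rightarrow> ('v, 'e) ugraph \<Rightarrow> (nat \<Rightarrow> ('v, 'e) ugraph) \<Rightarrow> (nat \<Rightarrow> ('v, 'e) pre_digraph) \<Rightarrow> bool"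
  where
  "oriented_cycle_double_cover k G C D \<longleftrightarrow>
     (\<forall>i<k. cycle_of (C i) G \<and> orientation_of (D i) (C i) \<and> directed_cycle (D i)) \<and>
     (\<forall>e\<in>edges G. card {i. i < k \<and> e \<in> edges (C i)} = 2 \<and>
        (\<forall>i<k. \<forall>j<k. i \<noteq> j \<and> e \<in> edges (C i) \<and> e \<in> edges (C j) \<longrightarrow>
           tail (D i) e = head (D j) e \<and> head (D i) e = tail (D j) e))"

definition golden_ratio :: real where
  "golden_ratio = (1 + sqrt 5) / 2"

end

(* Given points p_0, ..., p_{k-1} whose pairwise distances lie in [1, r - 1], orient every edge e as
   in one of the two directed cycles C_i, C_j containing it, say C_i, and let phi(e) = p_i - p_j. As
   e is reversed in C_j, phi is the sum of the flows p_i * C_i, hence a flow. The three bounds come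
   from the equilateral triangle, the square and the regular pentagon of side 1, whose diameters
   are 1, sqrt 2 and the golden ratio. *)

theory Submission
  imports Defs
begin

text \<open>This puts Kirchhoff's law at \<open>v\<close> into the form of one sum weighted by
  signed incidences, open to linearity and interchange of summation. A loop at \<open>v\<close> gets
  coefficient 0, as it lies in both arc sets.\<close>

lemma sum_out_arcs_minus_sum_in_arcs:
  fixes f :: "'e \<Rightarrow> 'a::real_vector"
  assumes "finite (arcs D)"
  shows "(\<Sum>e\<in>out_arcs D v. f e) - (\<Sum>e\<in>in_arcs D v. f e) =
    (\<Sum>e\<in>arcs D. (of_bool (tail D e = v) - of_bool (head D e = v)) *\<^sub>R f e)"
proof -
  have "(\<Sum>e\<in>out_arcs D v. f e) = (\<Sum>e\<in>arcs D. if tail D e = v then f e else 0)"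
    using assms by (simp add: out_arcs_def sum.inter_filter)
  moreover have "(\<Sum>e\<in>in_arcs D v. f e) = (\<Sum>e\<in>arcs D. if head D e = v then f e else 0)"
    using assms by (simp add: in_arcs_def sum.inter_filter)
  ultimately show ?thesis
    by (simp add: sum_subtractf [symmetric]) (intro sum.cong, auto)
qed

text \<open>Here \<open>v\<close> is arbitrary, since a flow on the whole graph is checked also at
  vertices that a cycle misses; there both degrees are 0.\<close>

lemma directed_cycle_balance:
  assumes "wf_ugraph C" "orientation_of D C" "directed_cycle D"
  shows "(\<Sum>e\<in>edges C. of_bool (tail D e = v) - of_bool (head D e = v)) = (0::real)"
proof -
  have D: "verts D = vertices C" "arcs D = edges C"
    and ends: "\<And>e. e \<in> edges C \<Longrightarrow> ends C e = {tail D e, head D e}"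
    using assms(2) by (auto simp: orientation_of_def)
  have "finite (arcs D)"
    using assms(1) D by (simp add: wf_ugraph_def)
  then have "(\<Sum>e\<in>edges C. of_bool (tail D e = v) - of_bool (head D e = v)) =
      real (out_degree D v) - real (in_degree D v)"
    using sum_out_arcs_minus_sum_in_arcs [of D "\<lambda>_. 1 :: real" v] D
    by (simp add: out_degree_def in_degree_def)
  moreover have "out_degree D v = in_degree D v"
  proof (cases "v \<in> vertices C")
    case True
    then show ?thesis using assms(3) D by (simp add: directed_cycle_def)
  next
    case False
    have "tail D e \<in> vertices C \<and> head D e \<in> vertices C" if "e \<in> edges C" for e
      using assms(1) ends [OF that] that
      by (fastforce simp: wf_ugraph_def doubleton_eq_iff)
    then have "out_arcs D v = {}" "in_arcs D v = {}"
      using False D by (auto simp: out_arcs_def in_arcs_def)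
    then show ?thesis by (simp add: out_degree_def in_degree_def)
  qed
  ultimately show ?thesis by simp
qed

lemma nowhere_zero_flow_of_points:
  fixes G :: "('v, 'e) ugraph" and p :: "nat \<Rightarrow> real ^ 'd"
  assumes "wf_ugraph G"
    and cover: "oriented_cycle_double_cover k G C D"
    and dist: "\<And>i j. i < j \<Longrightarrow> j < k \<Longrightarrow> dist (p i) (p j) \<in> {1..r - 1}"
  shows "\<exists>O' (\<phi> :: 'e \<Rightarrow> real ^ 'd). nowhere_zero_flow r G O' \<phi>"
proof -
  have fin: "finite (edges G)"
    using assms(1) by (simp add: wf_ugraph_def)
  have sub: "wf_ugraph (C i)" "edges (C i) \<subseteq> edges G" "directed_cycle (D i)"
    "orientation_of (D i) (C i)" if "i < k" for i
    using cover that
    by (auto simp: oriented_cycle_double_cover_def cycle_of_def subgraph_of_def)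
  have ends: "ends G e = {tail (D i) e, head (D i) e}" if "i < k" "e \<in> edges (C i)" for i e
    using cover that
    unfolding oriented_cycle_double_cover_def cycle_of_def subgraph_of_def orientation_of_def
    by metis
  have "\<forall>e\<in>edges G. \<exists>a b. {i. i < k \<and> e \<in> edges (C i)} = {a, b} \<and> a \<noteq> b"
    using cover by (auto simp: oriented_cycle_double_cover_def card_2_iff)
  then obtain a b where ab:
    "\<And>e. e \<in> edges G \<Longrightarrow> {i. i < k \<and> e \<in> edges (C i)} = {a e, b e} \<and> a e \<noteq> b e"
    by metis
  then have mem: "a e < k" "b e < k" "e \<in> edges (C (a e))" "e \<in> edges (C (b e))"
    if "e \<in> edges G" for e
    using that by blast+
  have opp: "tail (D (b e)) e = head (D (a e)) e" "head (D (b e)) e = tail (D (a e)) e"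
    if "e \<in> edges G" for e
    using cover mem [OF that] ab [OF that] that
    unfolding oriented_cycle_double_cover_def by metis+
  \<comment> \<open>Swapping \<open>a e\<close> and \<open>b e\<close> reverses the arc and negates
    its flow value, so either choice will do.\<close>
  define O' where "O' = \<lparr>verts = vertices G, arcs = edges G,
    tail = \<lambda>e. tail (D (a e)) e, head = \<lambda>e. head (D (a e)) e\<rparr>"
  define \<phi> where "\<phi> e = p (a e) - p (b e)" for e
  define s where "s v i e = (of_bool (tail (D i) e = v) - of_bool (head (D i) e = v) :: real)"
    for v i e
  have "orientation_of O' G"
    using ends mem by (simp add: orientation_of_def O'_def)
  moreover have "norm (\<phi> e) \<in> {1..r - 1}" if "e \<in> edges G" for e
    using dist [of "a e" "b e"] dist [of "b e" "a e"] mem [OF that] ab [OF that]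
    by (cases "a e < b e") (auto simp: \<phi>_def dist_norm norm_minus_commute)
  moreover have "(\<Sum>e\<in>out_arcs O' v. \<phi> e) = (\<Sum>e\<in>in_arcs O' v. \<phi> e)" for v
  proof -
    have "(\<Sum>e\<in>out_arcs O' v. \<phi> e) - (\<Sum>e\<in>in_arcs O' v. \<phi> e) =
        (\<Sum>e\<in>edges G. s v (a e) e *\<^sub>R \<phi> e)"
      using sum_out_arcs_minus_sum_in_arcs [of O' \<phi> v] fin by (simp add: O'_def s_def)
    \<comment> \<open>The two cycles through \<open>e\<close> give it opposite signs at
      \<open>v\<close>, which absorbs the minus sign in \<open>p (a e) - p (b e)\<close>.\<close>
    also have "\<dots> = (\<Sum>e\<in>edges G. \<Sum>i | i \<in> {..<k} \<and> e \<in> edges (C i). s v i e *\<^sub>R p i)"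
    proof (rule sum.cong [OF refl])
      fix e assume e: "e \<in> edges G"
      have "s v (b e) e = - s v (a e) e"
        using opp [OF e] by (simp add: s_def)
      then show "s v (a e) e *\<^sub>R \<phi> e =
          (\<Sum>i | i \<in> {..<k} \<and> e \<in> edges (C i). s v i e *\<^sub>R p i)"
        using ab [OF e] by (simp add: \<phi>_def scaleR_right_diff_distrib)
    qed
    \<comment> \<open>After the swap, each point \<open>p i\<close> is multiplied by the net outflow
      of the cycle \<open>C i\<close> at \<open>v\<close>, which is 0.\<close>
    also have "\<dots> = (\<Sum>i<k. \<Sum>e | e \<in> edges G \<and> e \<in> edges (C i). s v i e *\<^sub>R p i)"
      using fin by (intro sum.swap_restrict) auto
    also have "\<dots> = (\<Sum>i<k. (\<Sum>e\<in>edges (C i). s v i e) *\<^sub>R p i)"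
    proof (rule sum.cong [OF refl])
      fix i assume "i \<in> {..<k}"
      then have "{e. e \<in> edges G \<and> e \<in> edges (C i)} = edges (C i)"
        using sub(2) by blast
      then show "(\<Sum>e | e \<in> edges G \<and> e \<in> edges (C i). s v i e *\<^sub>R p i) =
          (\<Sum>e\<in>edges (C i). s v i e) *\<^sub>R p i"
        by (simp add: scaleR_left.sum)
    qed
    also have "\<dots> = 0"
      by (simp add: s_def directed_cycle_balance [OF sub(1,4,3)])
    finally show ?thesis by simp
  qed
  ultimately show ?thesis
    unfolding nowhere_zero_flow_def by blast
qed

lemma flow_number_le:
  fixes \<phi> :: "'e \<Rightarrow> real ^ 'd"
  assumes "2 \<le> r" "nowhere_zero_flow r G D \<phi>"
  shows "flow_number TYPE('d) G \<le> r"
  unfolding flow_number_def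
  using assms by (intro cInf_lower bdd_belowI [of _ 2]) auto

text \<open>Every member of the set is at least 2; the given flow ensures that the set is nonempty,
  without which \<open>Inf\<close> would obey no such bound.\<close>

lemma flow_number_ge_2:
  fixes \<phi> :: "'e \<Rightarrow> real ^ 'd"
  assumes "2 \<le> r" "nowhere_zero_flow r G D \<phi>"
  shows "2 \<le> flow_number TYPE('d) G"
  unfolding flow_number_def
  using assms by (intro cInf_greatest) auto

lemma dist_vector_2:
  "dist (vector [a, b] :: real ^ 2) (vector [c, d]) = sqrt ((a - c)\<^sup>2 + (b - d)\<^sup>2)"
  by (simp add: dist_vec_def L2_set_def sum_2 dist_real_def)

lemma triangle_points:
  "\<exists>p :: nat \<Rightarrow> real ^ 2. \<forall>i j. i < j \<longrightarrow> j < 3 \<longrightarrow> dist (p i) (p j) = 1"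
proof -
  define p :: "nat \<Rightarrow> real ^ 2" where
    "p i = [vector [0, 0], vector [1, 0], vector [1/2, sqrt 3 / 2]] ! i" for i
  have "dist (p i) (p j) = 1" if "i < j" "j < 3" for i j
  proof -
    have "(i, j) \<in> {(0,1), (0,2), (1,2)}"
      using that by (auto simp: numeral_eq_Suc less_Suc_eq)
    then show ?thesis
      by (auto simp: p_def dist_vector_2 power_divide power2_eq_square)
  qed
  then show ?thesis by blast
qed

lemma square_points:
  "\<exists>p :: nat \<Rightarrow> real ^ 2. \<forall>i j. i < j \<longrightarrow> j < 4 \<longrightarrow> dist (p i) (p j) \<in> {1..sqrt 2}"
proof -
  define p :: "nat \<Rightarrow> real ^ 2" where
    "p i = [vector [0, 0], vector [1, 0], vector [1, 1], vector [0, 1]] ! i" for i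
  have "dist (p i) (p j) \<in> {1..sqrt 2}" if "i < j" "j < 4" for i j
  proof -
    have "(i, j) \<in> {(0,1), (0,2), (0,3), (1,2), (1,3), (2,3)}"
      using that by (auto simp: numeral_eq_Suc less_Suc_eq)
    then show ?thesis
      by (auto simp: p_def dist_vector_2)
  qed
  then show ?thesis by blast
qed

lemma golden_ratio_square: "golden_ratio\<^sup>2 = golden_ratio + 1"
  by (simp add: golden_ratio_def power2_eq_square field_simps)

lemma golden_ratio_ge_1: "1 \<le> golden_ratio"
  by (simp add: golden_ratio_def)

lemma pentagon_points:
  "\<exists>p :: nat \<Rightarrow> real ^ 2. \<forall>i j. i < j \<longrightarrow> j < 5 \<longrightarrow> dist (p i) (p j) \<in> {1..golden_ratio}"
proof -
  define t where "t = golden_ratio"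
  have t: "t\<^sup>2 = t + 1" "1 \<le> t"
    unfolding t_def by (rule golden_ratio_square golden_ratio_ge_1)+
  \<comment> \<open>\<open>h\<close> is the sine of 72 degrees.\<close>
  define h where "h = sqrt ((t + 2) / 4)"
  have h: "h\<^sup>2 = (t + 2) / 4"
    using t by (simp add: h_def)
  \<comment> \<open>Rewrite rules that lower powers of \<open>t\<close> and \<open>h\<close>; the
    versions with \<open>x\<close> catch squares inside longer products.\<close>
  have tt: "t * t = t + 1" "t * (t * x) = (t + 1) * x"
    and hh: "h * h = (t + 2) / 4" "h * (h * x) = (t + 2) / 4 * x" for x
    using t(1) h by (simp_all add: power2_eq_square flip: mult.assoc)
  \<comment> \<open>The base is the first side. The outer vertices end a horizontal diagonal of
    length \<open>t\<close>; their height is \<open>h\<close> because the exterior angle is 72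
    degrees. The apex and the base form an isosceles triangle with legs \<open>t\<close> and base
    angles of 72 degrees, whence the height \<open>t * h\<close>.\<close>
  define p :: "nat \<Rightarrow> real ^ 2" where
    "p i = [vector [-1/2, 0], vector [1/2, 0], vector [t/2, h], vector [0, t * h],
      vector [-t/2, h]] ! i" for i
  have sq: "(dist (p i) (p j))\<^sup>2 = 1 \<or> (dist (p i) (p j))\<^sup>2 = t\<^sup>2" if "i < j" "j < 5" for i j
  proof -
    have "(i, j) \<in> {(0,1), (0,2), (0,3), (0,4), (1,2), (1,3), (1,4), (2,3), (2,4), (3,4)}"
      using that by (auto simp: numeral_eq_Suc less_Suc_eq)
    \<comment> \<open>One identity per pair, in the order of the list above: value 1 for the five
      sides, \<open>t\<^sup>2\<close> for the five diagonals.\<close>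
    moreover have
      "(-1/2 - 1/2)\<^sup>2 + (0 - 0)\<^sup>2 = (1::real)"
      "(-1/2 - t/2)\<^sup>2 + (0 - h)\<^sup>2 = t\<^sup>2"
      "(-1/2 - 0)\<^sup>2 + (0 - t * h)\<^sup>2 = t\<^sup>2"
      "(-1/2 - (-t/2))\<^sup>2 + (0 - h)\<^sup>2 = 1"
      "(1/2 - t/2)\<^sup>2 + (0 - h)\<^sup>2 = 1"
      "(1/2 - 0)\<^sup>2 + (0 - t * h)\<^sup>2 = t\<^sup>2"
      "(1/2 - (-t/2))\<^sup>2 + (0 - h)\<^sup>2 = t\<^sup>2"
      "(t/2 - 0)\<^sup>2 + (h - t * h)\<^sup>2 = 1"
      "(t/2 - (-t/2))\<^sup>2 + (h - h)\<^sup>2 = t\<^sup>2"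
      "(0 - (-t/2))\<^sup>2 + (t * h - h)\<^sup>2 = 1"
      by (simp_all add: power2_eq_square field_simps tt hh)
    ultimately show ?thesis
      by (auto simp: p_def dist_vector_2 simp del: diff_0 diff_0_right minus_divide_left)
  qed
  have "dist (p i) (p j) \<in> {1..t}" if "i < j" "j < 5" for i j
    \<comment> \<open>Nonnegativity selects the roots 1 and \<open>t\<close>.\<close>
    using sq [OF that] t(2) zero_le_dist [of "p i" "p j"]
    by (auto simp: power2_eq_1_iff power2_eq_iff)
  then show ?thesis unfolding t_def by blast
qed

theorem theorem4:
  fixes G :: "('v, 'e) ugraph" and k :: nat
  assumes "wf_ugraph G"
    and "bridgeless G"
    and "k \<in> {2, 3, 4, 5}"
    and "\<exists>C D. oriented_cycle_double_cover k G C D"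
  shows "(k \<le> 3 \<longrightarrow> flow_number TYPE(2) G = 2) \<and>
    (k = 4 \<longrightarrow> flow_number TYPE(2) G \<le> 1 + sqrt 2) \<and>
    (k = 5 \<longrightarrow> flow_number TYPE(2) G \<le> golden_ratio ^ 2)"
proof -
  have flow: "\<exists>O' (\<phi> :: 'e \<Rightarrow> real ^ 2). nowhere_zero_flow r G O' \<phi>"
    if "\<exists>p :: nat \<Rightarrow> real ^ 2. \<forall>i j. i < j \<longrightarrow> j < k \<longrightarrow> dist (p i) (p j) \<in> {1..r - 1}" for r
    using that assms(4) nowhere_zero_flow_of_points [OF assms(1)] by metis
  have "flow_number TYPE(2) G = 2" if "k \<le> 3"
  proof -
    obtain p :: "nat \<Rightarrow> real ^ 2" where "\<forall>i j. i < j \<longrightarrow> j < 3 \<longrightarrow> dist (p i) (p j) = 1"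
      using triangle_points by blast
    \<comment> \<open>For \<open>k = 2\<close> the first two corners are used. For
      \<open>r = 2\<close> the interval is the single point 1, so an equilateral configuration is
      forced.\<close>
    then have "\<forall>i j. i < j \<longrightarrow> j < k \<longrightarrow> dist (p i) (p j) \<in> {1..2 - 1}"
      using that by simp
    then show ?thesis
      using flow flow_number_le [of 2 G] flow_number_ge_2 [of 2 G]
      by (metis order.refl order.antisym)
  qed
  moreover have "flow_number TYPE(2) G \<le> 1 + sqrt 2" if "k = 4"
    using flow [of "1 + sqrt 2"] square_points that flow_number_le [of "1 + sqrt 2" G] by auto
  moreover have "flow_number TYPE(2) G \<le> golden_ratio ^ 2" if "k = 5"
    \<comment> \<open>As \<open>golden_ratio\<^sup>2 - 1 = golden_ratio\<close>, the pentagon's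
      diameter is exactly \<open>r - 1\<close>; \<open>1 \<le> golden_ratio\<close> yields
      \<open>2 \<le> r\<close>.\<close>
    using flow [of "golden_ratio ^ 2"] pentagon_points that golden_ratio_ge_1
      flow_number_le [of "golden_ratio ^ 2" G]
    by (auto simp: golden_ratio_square)
  ultimately show ?thesis by blast
qed

end
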